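(* Let $\mathcal A$ be a (unital) $K$-algebra which is a direct product of indecomposable unital rings and let $\alpha=\{\alpha_g:\mathcal D_{g^{-1}}\to\mathcal D_g\mid g\in G\}$ be a (not necessarily transitive) unital partial action of a group $G$ on $\mathcal A$. Then for any $n\ge 0$ each cocycle $w\in Z^n_{par}(G,\mathcal A)$ is globalizable.
   Context: $K$ is a commutative unital ring; algebras are associative $K$-algebras, not necessarily commutative. A unital ring is indecomposable if it is nonzero and its only central idempotents are $0$ and $1$. A partial action $\alpha$ of $G$ on an algebra $\mathcal A$ is a family of two-sided ideals $\mathcal D_g$ and algebra isomorphisms $\alpha_g:\mathcal D_{g^{-1}}\to\mathcal D_g$ ($g\in G$) such that $\alpha_1=\mathrm{id}_{\mathcal A}$, and whenever $a\in\mathcal D_{h^{-1}}$ and $\alpha_h(a)\in\mathcal D_{g^{-1}}$, then $a\in\mathcal D_{(gh)^{-1}}$ and $\alpha_g(\alpha_h(a))=\alpha_{gh}(a)$. It is unital if $\mathcal D_g=1_g\mathcal A$ for a central idempotent $1_g$ of $\mathcal A$. It is transitive (for $\mathcal A=\prod_{\lambda\in\Lambda}\mathcal A_\lambda$ with $\mathcal A_\lambda$ indecomposable) if for all $\lambda',\lambda''\in\Lambda$ there is $x\in G$ with $\mathcal A_{\lambda'}\subseteq\mathcal D_{x^{-1}}$ and $\alpha_x(\mathcal A_{\lambda'})=\mathcal A_{\lambda''}$. Put $1_{(g_1,\dots,g_n)}=1_{g_1}1_{g_1g_2}\cdots1_{g_1\cdots g_n}$ and let $C^0_{par}(G,\mathcal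 A)=\mathcal A$, $C^n_{par}(G,\mathcal A)=\{f:G^n\to\mathcal A\mid f(g_1,\dots,g_n)\in1_{(g_1,\dots,g_n)}\mathcal A\}$ for $n\ge1$. Let $(\delta^0a)(g)=\alpha_g(1_{g^{-1}}a)-1_ga$ and, for $n\ge1$, $$(\delta^nf)(g_1,\dots,g_{n+1})=\alpha_{g_1}(1_{g_1^{-1}}f(g_2,\dots,g_{n+1}))+\sum_{i=1}^n(-1)^i1_{g_1\cdots g_i}f(g_1,\dots,g_ig_{i+1},\dots,g_{n+1})+(-1)^{n+1}1_{g_1\cdots g_{n+1}}f(g_1,\dots,g_n).$$ $Z^n_{par}(G,\mathcal A)=\ker\delta^n$. An enveloping action of $(\mathcal A,\alpha)$ is a (global) action $\beta$ of $G$ by automorphisms on an algebra $\mathcal B$ (possibly without $1$) with an injective algebra homomorphism $\varphi:\mathcal A\to\mathcal B$ such that $\varphi(\mathcal A)$ is a two-sided ideal of $\mathcal B$, $\mathcal B=\sum_{g\in G}\beta_g(\varphi(\mathcal A))$, $\varphi(\mathcal D_g)=\varphi(\mathcal A)\cap\beta_g(\varphi(\mathcal A))$, and $\varphi\circ\alpha_g=\beta_g\circ\varphi$ on $\mathcal D_{g^{-1}}$. For a unital partial action an enveloping action exists and is unique up to isomorphism; fix one. The multiplier algebra is $\mathcal M(\mathcal B)=\{(R,L)\in\mathrm{End}({}_{\mathcal B}\mathcal B)\times\mathrm{End}(\mathcal B_{\mathcal B}) : (aR)b=a(Lb)\ \forall a,b\in\mathcal B\}$ (left module maps written on the right); for $\gamma=(R,L)$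 write $b\gamma=bR$, $\gamma b=Lb$. $G$ acts on it by $\beta^*_g(u)=\beta_gu\beta_g^{-1}$. $Z^n(G,\mathcal M(\mathcal B))$ is the group of classical $n$-cocycles of $G$ with values in the additive group of $\mathcal M(\mathcal B)$ with this action. A cocycle $w\in Z^n_{par}(G,\mathcal A)$ is globalizable if there is $u\in Z^n(G,\mathcal M(\mathcal B))$ (a globalization of $w$) with $\varphi(w(g_1,\dots,g_n))=\varphi(1_{(g_1,\dots,g_n)})u(g_1,\dots,g_n)$ for all $g_1,\dots,g_n\in G$; for $n=0$ this reads $\varphi(w)=\varphi(1_{\mathcal A})u$. *)

theory Defs
  imports "HOL-Library.FuncSet" "HOL-Library.Function_Algebras" "HOL-Library.Product_Plus"
begin

text \<open>
  Conventions. A group is a type of class \<open>group_add\<close>, which is not assumed commutative: the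
  product \<open>gh\<close> is written \<open>g + h\<close>, the inverse \<open>- g\<close> and the neutral element \<open>0\<close>.
  A not necessarily unital ring is a type of class \<open>ring\<close>, a unital ring is one of sort
  \<open>{ring, monoid_mult}\<close>. The class \<open>ring_1\<close> (and hence \<open>comm_ring_1\<close> and the locale \<open>module\<close>) is
  avoided because it excludes the zero ring.
  An \<open>n\<close>-tuple of group elements is a list of length \<open>n\<close>; a map on \<open>G^n\<close> is a function on lists of
  which only the values on lists of length \<open>n\<close> matter. For \<open>n = 0\<close> it amounts to its value at \<open>[]\<close>.
\<close>

section \<open>Algebras, ideals, direct products\<close>

locale assoc_algebra =
  fixes scale :: "'k::{comm_ring,comm_monoid_mult} \<Rightarrow> 'b::ring \<Rightarrow> 'b"
  assumes scale_add_right: "scale r (x + y) = scale r x + scale r y"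
    and scale_add_left: "scale (r + s) x = scale r x + scale s x"
    and scale_scale: "scale r (scale s x) = scale (r * s) x"
    and scale_one: "scale 1 x = x"
    and mult_scale_left: "scale r x * y = scale r (x * y)"
    and mult_scale_right: "x * scale r y = scale r (x * y)"

definition two_sided_ideal ::
  "('k::{comm_ring,comm_monoid_mult} \<Rightarrow> 'b::ring \<Rightarrow> 'b) \<Rightarrow> 'b set \<Rightarrow> bool" where
  "two_sided_ideal scale I \<longleftrightarrow>
     0 \<in> I \<and> (\<forall>x\<in>I. \<forall>y\<in>I. x + y \<in> I) \<and> (\<forall>x\<in>I. - x \<in> I) \<and> (\<forall>r. \<forall>x\<in>I. scale r x \<in> I) \<and>
     (\<forall>a. \<forall>x\<in>I. a * x \<in> I \<and> x * a \<in> I)"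

text \<open>Algebra homomorphisms on a (sub)algebra \<open>S\<close>; preservation of units is not required.\<close>

definition algebra_hom_on ::
  "('k::{comm_ring,comm_monoid_mult} \<Rightarrow> 'a::ring \<Rightarrow> 'a) \<Rightarrow> ('k \<Rightarrow> 'b::ring \<Rightarrow> 'b) \<Rightarrow>
     'a set \<Rightarrow> ('a \<Rightarrow> 'b) \<Rightarrow> bool" where
  "algebra_hom_on scaleA scaleB S f \<longleftrightarrow>
     (\<forall>x\<in>S. \<forall>y\<in>S. f (x + y) = f x + f y) \<and>
     (\<forall>x\<in>S. \<forall>y\<in>S. f (x * y) = f x * f y) \<and>
     (\<forall>r. \<forall>x\<in>S. f (scaleA r x) = scaleB r (f x))"

definition ring_on :: "'r::ring set \<Rightarrow> bool" where
  "ring_on R \<longleftrightarrow>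
     0 \<in> R \<and> (\<forall>x\<in>R. \<forall>y\<in>R. x + y \<in> R) \<and> (\<forall>x\<in>R. - x \<in> R) \<and> (\<forall>x\<in>R. \<forall>y\<in>R. x * y \<in> R)"

definition indecomposable_unital_ring_on :: "'r::ring set \<Rightarrow> bool" where
  "indecomposable_unital_ring_on R \<longleftrightarrow>
     ring_on R \<and> R \<noteq> {0} \<and>
     (\<exists>u\<in>R. (\<forall>x\<in>R. u * x = x \<and> x * u = x) \<and>
        (\<forall>f\<in>R. f * f = f \<and> (\<forall>x\<in>R. f * x = x * f) \<longrightarrow> f = 0 \<or> f = u))"

text \<open>
  \<open>\<Psi>\<close> identifies the ring \<open>'a\<close> with the direct product of the rings \<open>R i\<close>, \<open>i \<in> \<Lambda>\<close>. The factors are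
  realised as subrings, with possibly different units, of one ambient non-unital ring \<open>'r\<close>; this is no
  restriction on the family, since any family of rings embeds in its direct sum.
\<close>

definition is_direct_product ::
  "('a::{ring,monoid_mult} \<Rightarrow> 'i \<Rightarrow> 'r::ring) \<Rightarrow> 'i set \<Rightarrow> ('i \<Rightarrow> 'r set) \<Rightarrow> bool" where
  "is_direct_product \<Psi> \<Lambda> R \<longleftrightarrow>
     bij_betw \<Psi> UNIV (Pi\<^sub>E \<Lambda> R) \<and>
     (\<forall>a b. \<forall>i\<in>\<Lambda>. \<Psi> (a + b) i = \<Psi> a i + \<Psi> b i) \<and>
     (\<forall>a b. \<forall>i\<in>\<Lambda>. \<Psi> (a * b) i = \<Psi> a i * \<Psi> b i)"

section \<open>Unital partial actions\<close>

locale partial_action = assoc_algebra scale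
  for scale :: "'k::{comm_ring,comm_monoid_mult} \<Rightarrow> 'a::{ring,monoid_mult} \<Rightarrow> 'a" +
  fixes D :: "'g::group_add \<Rightarrow> 'a set" and \<alpha> :: "'g \<Rightarrow> 'a \<Rightarrow> 'a"
  assumes ideal_D: "two_sided_ideal scale (D g)"
    and bij_\<alpha>: "bij_betw (\<alpha> g) (D (- g)) (D g)"
    and hom_\<alpha>: "algebra_hom_on scale scale (D (- g)) (\<alpha> g)"
    and D_0: "D 0 = UNIV"
    and \<alpha>_0: "\<alpha> 0 a = a"
    and dom_comp: "a \<in> D (- h) \<Longrightarrow> \<alpha> h a \<in> D (- g) \<Longrightarrow> a \<in> D (- (g + h))"
    and \<alpha>_comp: "a \<in> D (- h) \<Longrightarrow> \<alpha> h a \<in> D (- g) \<Longrightarrow> \<alpha> g (\<alpha> h a) = \<alpha> (g + h) a"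

text \<open>Here \<open>e g\<close> is the idempotent \<open>1_g\<close>; it is determined by \<open>D g\<close>.\<close>

locale unital_partial_action = partial_action scale D \<alpha>
  for scale :: "'k::{comm_ring,comm_monoid_mult} \<Rightarrow> 'a::{ring,monoid_mult} \<Rightarrow> 'a"
    and D :: "'g::group_add \<Rightarrow> 'a set" and \<alpha> :: "'g \<Rightarrow> 'a \<Rightarrow> 'a" +
  fixes e :: "'g \<Rightarrow> 'a"
  assumes e_idem: "e g * e g = e g"
    and e_central: "e g * a = a * e g"
    and D_eq: "D g = range (\<lambda>a. e g * a)"

section \<open>Partial and classical cocycles\<close>

definition alt_sign :: "nat \<Rightarrow> 'm::ab_group_add \<Rightarrow> 'm" where
  "alt_sign i x = (if even i then x else - x)"

text \<open>\<open>merge_at i [g_1, \<dots>, g_m] = [g_1, \<dots>, g_i g_(i+1), \<dots>, g_m]\<close> for \<open>1 \<le> i < m\<close>; list positions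
  start at \<open>0\<close>.\<close>

definition merge_at :: "nat \<Rightarrow> 'g::group_add list \<Rightarrow> 'g list" where
  "merge_at i gs = take (i - 1) gs @ [gs ! (i - 1) + gs ! i] @ drop (i + 1) gs"

definition tuple_idem :: "('g::group_add \<Rightarrow> 'a::{ring,monoid_mult}) \<Rightarrow> 'g list \<Rightarrow> 'a" where
  "tuple_idem e gs = prod_list (map (\<lambda>i. e (sum_list (take i gs))) [1..<Suc (length gs)])"

definition par_cochains ::
  "('g::group_add \<Rightarrow> 'a::{ring,monoid_mult}) \<Rightarrow> nat \<Rightarrow> ('g list \<Rightarrow> 'a) set" where
  "par_cochains e n = {f. \<forall>gs. length gs = n \<longrightarrow> f gs \<in> range (\<lambda>a. tuple_idem e gs * a)}"

text \<open>The argument \<open>gs\<close> has length \<open>n + 1\<close>.\<close>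

definition par_coboundary ::
  "('g::group_add \<Rightarrow> 'a \<Rightarrow> 'a) \<Rightarrow> ('g \<Rightarrow> 'a::{ring,monoid_mult}) \<Rightarrow> nat \<Rightarrow>
     ('g list \<Rightarrow> 'a) \<Rightarrow> 'g list \<Rightarrow> 'a" where
  "par_coboundary \<alpha> e n f gs =
     \<alpha> (hd gs) (e (- hd gs) * f (tl gs))
     + (\<Sum>i=1..n. alt_sign i (e (sum_list (take i gs)) * f (merge_at i gs)))
     + alt_sign (n + 1) (e (sum_list gs) * f (butlast gs))"

definition par_cocycles ::
  "('g::group_add \<Rightarrow> 'a \<Rightarrow> 'a) \<Rightarrow> ('g \<Rightarrow> 'a::{ring,monoid_mult}) \<Rightarrow> nat \<Rightarrow>
     ('g list \<Rightarrow> 'a) set" where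
  "par_cocycles \<alpha> e n =
     {f \<in> par_cochains e n. \<forall>gs. length gs = n + 1 \<longrightarrow> par_coboundary \<alpha> e n f gs = 0}"

text \<open>Consistency with the separate conventions for degree zero.\<close>

lemma tuple_idem_Nil: "tuple_idem e [] = 1"
  by (simp add: tuple_idem_def)

lemma par_cochains_0: "par_cochains e 0 = UNIV"
  by (auto simp: par_cochains_def tuple_idem_Nil)

lemma par_coboundary_0: "par_coboundary \<alpha> e 0 f [g] = \<alpha> g (e (- g) * f []) - e g * f []"
  by (simp add: par_coboundary_def alt_sign_def)

text \<open>Classical cocycles with values in a subgroup \<open>M\<close>, on which \<open>G\<close> acts by \<open>act\<close>.\<close>

definition coboundary ::
  "('g::group_add \<Rightarrow> 'm \<Rightarrow> 'm) \<Rightarrow> nat \<Rightarrow> ('g list \<Rightarrow> 'm::ab_group_add) \<Rightarrow> 'g list \<Rightarrow> 'm" where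
  "coboundary act n f gs =
     act (hd gs) (f (tl gs))
     + (\<Sum>i=1..n. alt_sign i (f (merge_at i gs)))
     + alt_sign (n + 1) (f (butlast gs))"

definition cocycles ::
  "('g::group_add \<Rightarrow> 'm \<Rightarrow> 'm) \<Rightarrow> 'm::ab_group_add set \<Rightarrow> nat \<Rightarrow> ('g list \<Rightarrow> 'm) set" where
  "cocycles act M n =
     {f. (\<forall>gs. length gs = n \<longrightarrow> f gs \<in> M) \<and>
         (\<forall>gs. length gs = n + 1 \<longrightarrow> coboundary act n f gs = 0)}"

section \<open>Enveloping actions, multipliers, globalization\<close>

locale enveloping_action =
  A: unital_partial_action scaleA D \<alpha> e + B: assoc_algebra scaleB
  for scaleA :: "'k::{comm_ring,comm_monoid_mult} \<Rightarrow> 'a::{ring,monoid_mult} \<Rightarrow> 'a"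
    and D :: "'g::group_add \<Rightarrow> 'a set" and \<alpha> :: "'g \<Rightarrow> 'a \<Rightarrow> 'a" and e :: "'g \<Rightarrow> 'a"
    and scaleB :: "'k \<Rightarrow> 'b::ring \<Rightarrow> 'b" +
  fixes \<beta> :: "'g \<Rightarrow> 'b \<Rightarrow> 'b" and \<phi> :: "'a \<Rightarrow> 'b"
  assumes bij_\<beta>: "bij (\<beta> g)"
    and hom_\<beta>: "algebra_hom_on scaleB scaleB UNIV (\<beta> g)"
    and \<beta>_0: "\<beta> 0 = id"
    and \<beta>_add: "\<beta> (g + h) = \<beta> g \<circ> \<beta> h"
    and inj_\<phi>: "inj \<phi>"
    and hom_\<phi>: "algebra_hom_on scaleA scaleB UNIV \<phi>"
    and ideal_\<phi>: "two_sided_ideal scaleB (range \<phi>)"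
    and generated: "\<exists>F c. finite F \<and> b = (\<Sum>g\<in>F. \<beta> g (\<phi> (c g)))"
    and \<phi>_D: "\<phi> ` D g = range \<phi> \<inter> \<beta> g ` range \<phi>"
    and \<phi>_\<alpha>: "a \<in> D (- g) \<Longrightarrow> \<phi> (\<alpha> g a) = \<beta> g (\<phi> a)"

text \<open>
  A multiplier is a pair \<open>(R, L)\<close> of a left and a right module endomorphism of \<open>B\<close> (both linear over
  the ground ring), where \<open>aR\<close> is written \<open>R a\<close>. Addition of multipliers is that of pairs of functions.
\<close>

definition multipliers ::
  "('k::{comm_ring,comm_monoid_mult} \<Rightarrow> 'b::ring \<Rightarrow> 'b) \<Rightarrow> (('b \<Rightarrow> 'b) \<times> ('b \<Rightarrow> 'b)) set" where
  "multipliers scale = {(R, L).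
     (\<forall>x y. R (x + y) = R x + R y) \<and> (\<forall>r x. R (scale r x) = scale r (R x)) \<and>
     (\<forall>b x. R (b * x) = b * R x) \<and>
     (\<forall>x y. L (x + y) = L x + L y) \<and> (\<forall>r x. L (scale r x) = scale r (L x)) \<and>
     (\<forall>x b. L (x * b) = L x * b) \<and>
     (\<forall>a b. R a * b = a * L b)}"

text \<open>
  The action \<open>\<beta>*_g(u) = \<beta>_g u \<beta>_g\<^sup>-\<^sup>1\<close>. In both components \<open>\<beta>_g\<^sup>-\<^sup>1\<close> is applied first: for \<open>R\<close>, written on
  the right, this is \<open>a \<mapsto> ((a \<beta>_g\<^sup>-\<^sup>1) R) \<beta>_g\<close>.
\<close>

definition multiplier_action ::
  "('g \<Rightarrow> 'b \<Rightarrow> 'b) \<Rightarrow> 'g \<Rightarrow> ('b \<Rightarrow> 'b) \<times> ('b \<Rightarrow> 'b) \<Rightarrow> ('b \<Rightarrow> 'b) \<times> ('b \<Rightarrow> 'b)" where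
  "multiplier_action \<beta> g u = (\<beta> g \<circ> fst u \<circ> inv (\<beta> g), \<beta> g \<circ> snd u \<circ> inv (\<beta> g))"

text \<open>For a multiplier \<open>u = (R, L)\<close> and \<open>b \<in> B\<close> the product \<open>bu\<close> is \<open>R b\<close>, that is, \<open>fst u b\<close>.\<close>

definition globalizable ::
  "('k::{comm_ring,comm_monoid_mult} \<Rightarrow> 'b::ring \<Rightarrow> 'b) \<Rightarrow> ('g::group_add \<Rightarrow> 'b \<Rightarrow> 'b) \<Rightarrow>
     ('a \<Rightarrow> 'b) \<Rightarrow> ('g \<Rightarrow> 'a::{ring,monoid_mult}) \<Rightarrow> nat \<Rightarrow> ('g list \<Rightarrow> 'a) \<Rightarrow> bool" where
  "globalizable scaleB \<beta> \<phi> e n w \<longleftrightarrow>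
     (\<exists>u \<in> cocycles (multiplier_action \<beta>) (multipliers scaleB) n.
        \<forall>gs. length gs = n \<longrightarrow> \<phi> (w gs) = fst (u gs) (\<phi> (tuple_idem e gs)))"

end

theory Submission
  imports Defs
begin

text \<open>
  A decomposition of \<open>\<A>\<close> into indecomposable factors amounts to a set \<open>P\<close> of block idempotents. The
  translates \<open>\<beta>\<^sub>g(\<phi>(p))\<close>, \<open>p \<in> P\<close>, are pairwise orthogonal central idempotents of \<open>\<B>\<close>; let \<open>X\<close> be the
  set of them. A multiplier of \<open>\<B>\<close> is the same as a family of elements \<open>c\<^sub>x \<in> x\<B>\<close>, \<open>x \<in> X\<close>. In these
  terms a classical cocycle lives on the action groupoid of \<open>G\<close> on \<open>X\<close> and a partial cocycle on its
  full subgroupoid over \<open>\<phi>(P)\<close>, which meets every orbit. Choosing \<open>s x \<in> G\<close> that carries some element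
  of \<open>\<phi>(P)\<close> to \<open>x\<close>, with \<open>s x = 1\<close> for \<open>x \<in> \<phi>(P)\<close>, defines a retraction of the groupoid onto this
  subgroupoid, and the pullback of a partial cocycle along the retraction is a globalization.
\<close>

section \<open>Signs, additive maps and merged tuples\<close>

lemma fst_alt_sign: "fst (alt_sign i q) = alt_sign i (fst q)"
  by (simp add: alt_sign_def)

lemma snd_alt_sign: "snd (alt_sign i q) = alt_sign i (snd q)"
  by (simp add: alt_sign_def)

lemma alt_sign_apply: "alt_sign i f b = alt_sign i (f b)"
  by (simp add: alt_sign_def fun_eq_iff)

lemma alt_sign_mult_right: "x * alt_sign i y = alt_sign i (x * y)" for x :: "'b::ring"
  by (simp add: alt_sign_def)

lemma alt_sign_mult_left: "alt_sign i y * x = alt_sign i (y * x)" for x :: "'b::ring"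
  by (simp add: alt_sign_def)

lemma sum_fun_apply: "(sum f A) b = (\<Sum>i\<in>A. f i b)"
  by (induction A rule: infinite_finite_induct) auto

lemma additive_alt_sign:
  assumes "\<And>x y. f (x + y) = f x + f y"
  shows "f (alt_sign i y) = alt_sign i (f y)"
proof -
  have "f 0 = 0"
    using assms[of 0 0] by simp
  then have "f (- y) = - f y"
    using assms[of "- y" y] by (simp add: eq_neg_iff_add_eq_0)
  then show ?thesis
    by (simp add: alt_sign_def)
qed

lemma additive_sum:
  assumes "\<And>x y. f (x + y) = f x + f y"
  shows "f (\<Sum>i\<in>A. h i) = (\<Sum>i\<in>A. f (h i :: 'x::ab_group_add) :: 'y::ab_group_add)"
proof -
  have "f 0 = 0"
    using assms[of 0 0] by simp
  then show ?thesis
    by (induction A rule: infinite_finite_induct) (auto simp: assms)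
qed

lemma merge_at_Cons_Cons: "merge_at (Suc 0) (g # h # gs) = (g + h) # gs"
  by (simp add: merge_at_def)

lemma merge_at_Suc_Cons: "0 < i \<Longrightarrow> merge_at (Suc i) (g # gs) = g # merge_at i gs"
  by (cases i) (simp_all add: merge_at_def)

lemma length_merge_at: "0 < i \<Longrightarrow> i < length gs \<Longrightarrow> length (merge_at i gs) = length gs - 1"
  by (auto simp: merge_at_def)

section \<open>Block idempotents\<close>

text \<open>An intrinsic encoding of the product decomposition, without index set or ambient ring.
  The last two clauses make \<A> map injectively and onto the product of the rings p\<A>; pairwise
  orthogonality is a consequence of minimality.\<close>

definition block_idempotents :: "'a::{ring,monoid_mult} set \<Rightarrow> bool" where
  "block_idempotents P \<longleftrightarrow>
     (\<forall>p\<in>P. p * p = p \<and> p \<noteq> 0 \<and> (\<forall>a. p * a = a * p)) \<and>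
     (\<forall>p\<in>P. \<forall>f. f * f = f \<and> (\<forall>a. f * a = a * f) \<and> p * f = f \<longrightarrow> f = 0 \<or> f = p) \<and>
     (\<forall>a. (\<forall>p\<in>P. p * a = 0) \<longrightarrow> a = 0) \<and>
     (\<forall>f. \<exists>a. \<forall>p\<in>P. p * a = p * f p)"

text \<open>The blocks are the elements of \<A> with one component a unit and all others
  zero.\<close>

lemma direct_product_block_idempotents:
  fixes \<Psi> :: "'a::{ring,monoid_mult} \<Rightarrow> 'i \<Rightarrow> 'r::ring"
  assumes ind: "\<And>i. i \<in> \<Lambda> \<Longrightarrow> indecomposable_unital_ring_on (R i)"
    and prod: "is_direct_product \<Psi> \<Lambda> R"
  shows "\<exists>P :: 'a set. block_idempotents P"
proof -
  have bij: "bij_betw \<Psi> UNIV (Pi\<^sub>E \<Lambda> R)"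
    and add: "\<And>a b i. i \<in> \<Lambda> \<Longrightarrow> \<Psi> (a + b) i = \<Psi> a i + \<Psi> b i"
    and mult: "\<And>a b i. i \<in> \<Lambda> \<Longrightarrow> \<Psi> (a * b) i = \<Psi> a i * \<Psi> b i"
    using prod by (auto simp: is_direct_product_def)
  have zero: "\<Psi> 0 i = 0" if "i \<in> \<Lambda>" for i
    using add[OF that, of 0 0] by simp
  have R0: "0 \<in> R i" if "i \<in> \<Lambda>" for i
    using ind[OF that] by (auto simp: indecomposable_unital_ring_on_def ring_on_def)
  have in_R: "\<Psi> a i \<in> R i" if "i \<in> \<Lambda>" for a i
    using bij that by (auto simp: bij_betw_def)
  have eqI: "a = b" if "\<And>i. i \<in> \<Lambda> \<Longrightarrow> \<Psi> a i = \<Psi> b i" for a b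
  proof -
    have "\<Psi> a \<in> Pi\<^sub>E \<Lambda> R" "\<Psi> b \<in> Pi\<^sub>E \<Lambda> R"
      using bij by (auto simp: bij_betw_def)
    then have "\<Psi> a = \<Psi> b"
      using that by (rule PiE_ext)
    then show ?thesis
      using bij by (auto simp: bij_betw_def inj_def)
  qed
  have ex: "\<exists>a. \<forall>i\<in>\<Lambda>. \<Psi> a i = f i" if "\<And>i. i \<in> \<Lambda> \<Longrightarrow> f i \<in> R i" for f
  proof -
    have "restrict f \<Lambda> \<in> Pi\<^sub>E \<Lambda> R"
      using that by auto
    then obtain a where "\<Psi> a = restrict f \<Lambda>"
      using bij unfolding bij_betw_def by (metis imageE)
    then show ?thesis
      by (intro exI[of _ a]) auto
  qed
  define U where "U i u \<longleftrightarrow> u \<in> R i \<and> u \<noteq> 0 \<and> (\<forall>x\<in>R i. u * x = x \<and> x * u = x) \<and>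
        (\<forall>f\<in>R i. f * f = f \<and> (\<forall>x\<in>R i. f * x = x * f) \<longrightarrow> f = 0 \<or> f = u)" for i u
  have "\<forall>i\<in>\<Lambda>. \<exists>u. U i u"
  proof
    fix i assume i: "i \<in> \<Lambda>"
    from ind[OF i] obtain u where u: "R i \<noteq> {0}" "u \<in> R i" "\<forall>x\<in>R i. u * x = x \<and> x * u = x"
      "\<forall>f\<in>R i. f * f = f \<and> (\<forall>x\<in>R i. f * x = x * f) \<longrightarrow> f = 0 \<or> f = u"
      unfolding indecomposable_unital_ring_on_def by blast
    have "u \<noteq> 0"
    proof
      assume "u = 0"
      with u(3) have "\<forall>x\<in>R i. x = 0"
        by auto
      with u(1) R0[OF i] show False
        by auto
    qed
    with u show "\<exists>u. U i u"
      unfolding U_def by blast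
  qed
  from bchoice[OF this] obtain u where U: "\<And>i. i \<in> \<Lambda> \<Longrightarrow> U i (u i)"
    by blast
  have u: "u i \<in> R i" "u i \<noteq> 0" "x \<in> R i \<Longrightarrow> u i * x = x" "x \<in> R i \<Longrightarrow> x * u i = x"
    and u_min: "f \<in> R i \<Longrightarrow> f * f = f \<Longrightarrow> (\<And>x. x \<in> R i \<Longrightarrow> f * x = x * f) \<Longrightarrow> f = 0 \<or> f = u i"
    if "i \<in> \<Lambda>" for i x f
    using U[OF that] unfolding U_def by blast+
  have "\<exists>a. \<forall>j\<in>\<Lambda>. \<Psi> a j = (if j = i then u j else 0)" for i
    by (rule ex) (auto simp: u R0)
  then obtain q where q: "\<And>i j. j \<in> \<Lambda> \<Longrightarrow> \<Psi> (q i) j = (if j = i then u j else 0)"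
    by metis
  have q_idem: "q i * q i = q i" for i
    by (rule eqI) (auto simp: mult q u)
  have q_nz: "q i \<noteq> 0" if "i \<in> \<Lambda>" for i
    using q[OF that, of i] u(2)[OF that] zero[OF that] by auto
  have q_central: "q i * a = a * q i" for i a
    by (rule eqI) (auto simp: mult q u in_R)
  have q_min: "f = 0 \<or> f = q i"
    if i: "i \<in> \<Lambda>" and f: "f * f = f" "\<And>a. f * a = a * f" "q i * f = f" for i f
  proof -
    have 1: "\<Psi> f j = 0" if "j \<in> \<Lambda>" "j \<noteq> i" for j
    proof -
      have "\<Psi> f j = \<Psi> (q i) j * \<Psi> f j"
        using mult[OF that(1)] f(3) by metis
      then show ?thesis
        using that by (simp add: q)
    qed
    have "\<Psi> f i = 0 \<or> \<Psi> f i = u i"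
    proof (rule u_min[OF i])
      show "\<Psi> f i \<in> R i"
        by (rule in_R[OF i])
      show "\<Psi> f i * \<Psi> f i = \<Psi> f i"
        using mult[OF i] f(1) by metis
      \<comment> \<open>Every element of the factor is a component of some element of \<A>, so
        centrality of \<open>f\<close> in \<A> passes to its component.\<close>
      fix x assume "x \<in> R i"
      then have "\<exists>a. \<forall>j\<in>\<Lambda>. \<Psi> a j = (if j = i then x else 0)"
        by (intro ex) (auto simp: R0)
      then obtain a where "\<Psi> a i = x"
        using i by auto
      then show "\<Psi> f i * x = x * \<Psi> f i"
        using mult[OF i] f(2) by metis
    qed
    then show ?thesis
      using 1 zero q by (metis eqI)
  qed
  have q_sep: "a = 0" if "\<And>i. i \<in> \<Lambda> \<Longrightarrow> q i * a = 0" for a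
  proof (rule eqI)
    fix i assume i: "i \<in> \<Lambda>"
    have "\<Psi> (q i * a) i = \<Psi> a i"
      using i by (simp add: mult q u in_R)
    then show "\<Psi> a i = \<Psi> 0 i"
      using that[OF i] by simp
  qed
  have q_complete: "\<exists>a. \<forall>i\<in>\<Lambda>. q i * a = q i * f (q i)" for f
  proof -
    obtain a where a: "\<forall>i\<in>\<Lambda>. \<Psi> a i = \<Psi> (f (q i)) i"
      using ex[of "\<lambda>i. \<Psi> (f (q i)) i"] in_R by auto
    have "q i * a = q i * f (q i)" if "i \<in> \<Lambda>" for i
      by (rule eqI) (use a that in \<open>auto simp: mult q\<close>)
    then show ?thesis
      by blast
  qed
  have "block_idempotents (q ` \<Lambda>)"
    unfolding block_idempotents_def
  proof (intro conjI)
    show "\<forall>p\<in>q ` \<Lambda>. p * p = p \<and> p \<noteq> 0 \<and> (\<forall>a. p * a = a * p)"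
      by (auto simp: q_idem q_nz intro: q_central)
    show "\<forall>p\<in>q ` \<Lambda>. \<forall>f. f * f = f \<and> (\<forall>a. f * a = a * f) \<and> p * f = f \<longrightarrow> f = 0 \<or> f = p"
    proof (intro ballI allI impI)
      fix p f assume "p \<in> q ` \<Lambda>" and f: "f * f = f \<and> (\<forall>a. f * a = a * f) \<and> p * f = f"
      then obtain i where i: "i \<in> \<Lambda>" "p = q i"
        by blast
      show "f = 0 \<or> f = p"
        using q_min[OF i(1), of f] f i(2) by blast
    qed
    show "\<forall>a. (\<forall>p\<in>q ` \<Lambda>. p * a = 0) \<longrightarrow> a = 0"
    proof (intro allI impI)
      fix a assume "\<forall>p\<in>q ` \<Lambda>. p * a = 0"
      then have "q i * a = 0" if "i \<in> \<Lambda>" for i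
        using that by simp
      then show "a = 0"
        by (rule q_sep)
    qed
    show "\<forall>f. \<exists>a. \<forall>p\<in>q ` \<Lambda>. p * a = p * f p"
      using q_complete by simp
  qed
  then show ?thesis ..
qed

section \<open>Blocks of the enveloping algebra\<close>

context enveloping_action
begin

lemma \<beta>_plus: "\<beta> g (x + y) = \<beta> g x + \<beta> g y"
  and \<beta>_mult: "\<beta> g (x * y) = \<beta> g x * \<beta> g y"
  using hom_\<beta>[of g] by (auto simp: algebra_hom_on_def)

lemma \<phi>_plus: "\<phi> (a + b) = \<phi> a + \<phi> b"
  and \<phi>_mult: "\<phi> (a * b) = \<phi> a * \<phi> b"
  using hom_\<phi> by (auto simp: algebra_hom_on_def)

lemma \<beta>_zero [simp]: "\<beta> g 0 = 0"
  using \<beta>_plus[of g 0 0] by simp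

lemma \<phi>_zero [simp]: "\<phi> 0 = 0"
  using \<phi>_plus[of 0 0] by simp

lemma \<phi>_eq_iff: "\<phi> a = \<phi> b \<longleftrightarrow> a = b"
  using inj_\<phi> by (auto simp: inj_def)

lemma \<beta>_eq_iff: "\<beta> g x = \<beta> g y \<longleftrightarrow> x = y"
  using bij_\<beta>[of g] by (auto simp: bij_def inj_def)

lemma \<beta>_\<beta>: "\<beta> g (\<beta> h x) = \<beta> (g + h) x"
  by (simp add: \<beta>_add)

lemma \<beta>_zero_group [simp]: "\<beta> 0 x = x"
  by (simp add: \<beta>_0)

lemma inv_\<beta>: "inv (\<beta> g) = \<beta> (- g)"
  by (rule inv_unique_comp) (simp_all add: fun_eq_iff \<beta>_\<beta>)

lemma range_\<phi>_mult: "\<phi> a * b \<in> range \<phi>" "b * \<phi> a \<in> range \<phi>"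
  using ideal_\<phi> by (auto simp: two_sided_ideal_def)

text \<open>Both products lie in the ideal \<phi>(\<A>), on which \<open>\<phi> 1\<close> is a
  two-sided unit, so both equal \<open>\<phi> 1 * b * \<phi> 1\<close>.\<close>

lemma \<phi>_one_central: "\<phi> 1 * b = b * \<phi> 1"
proof -
  obtain c d where "\<phi> 1 * b = \<phi> c" "b * \<phi> 1 = \<phi> d"
    using range_\<phi>_mult by (meson imageE)
  then have "\<phi> 1 * b * \<phi> 1 = \<phi> 1 * b" "\<phi> 1 * (b * \<phi> 1) = b * \<phi> 1"
    by (simp_all add: \<phi>_mult[symmetric])
  then show ?thesis
    by (simp add: mult.assoc)
qed

text \<open>As \<open>\<phi> p\<close> absorbs \<open>\<phi> 1\<close>, the factor \<open>b\<close>
  may be replaced by \<open>\<phi> 1 * b\<close>, which lies in \<phi>(\<A>), where centrality of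
  \<open>p\<close> applies.\<close>

lemma \<phi>_central:
  assumes "\<And>a. p * a = a * p"
  shows "\<phi> p * b = b * \<phi> p"
proof -
  obtain c where c: "\<phi> 1 * b = \<phi> c"
    using range_\<phi>_mult by (meson imageE)
  have p: "\<phi> p * \<phi> 1 = \<phi> p" "\<phi> 1 * \<phi> p = \<phi> p"
    by (simp_all add: \<phi>_mult[symmetric])
  have "\<phi> p * b = \<phi> p * (\<phi> 1 * b)"
    by (simp add: p mult.assoc[symmetric])
  also have "\<dots> = (\<phi> 1 * b) * \<phi> p"
    by (simp add: c \<phi>_mult[symmetric] assms)
  also have "\<dots> = b * \<phi> p"
    by (simp add: \<phi>_one_central mult.assoc p)
  finally show ?thesis .
qed

lemma \<beta>_central:
  assumes "\<And>b. x * b = b * x"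
  shows "\<beta> g x * b = b * \<beta> g x"
proof -
  have "b = \<beta> g (\<beta> (- g) b)"
    by (simp add: \<beta>_\<beta>)
  then show ?thesis
    by (metis \<beta>_mult assms)
qed

text \<open>Induction on \<open>F\<close>: subtracting \<open>\<beta> h (\<phi> 1) * b\<close>,
  which is zero, from \<open>b\<close> removes the summand of \<open>h\<close> and changes the other
  coefficients. This is why the coefficients \<open>c g\<close> are arbitrary elements of
  \<B>.\<close>

lemma translated_units_separate_aux:
  assumes "finite F" "b = (\<Sum>g\<in>F. \<beta> g (\<phi> 1) * c g)" "\<And>g. g \<in> F \<Longrightarrow> \<beta> g (\<phi> 1) * b = 0"
  shows "b = 0"
  using assms
proof (induction F arbitrary: b c rule: finite_induct)
  case (insert h F)
  let ?u = "\<lambda>g. \<beta> g (\<phi> 1)"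
  have comm: "?u g * b = b * ?u g" for g b
    by (intro \<beta>_central \<phi>_one_central)
  have idem: "?u h * ?u h = ?u h"
    by (simp add: \<beta>_mult[symmetric] \<phi>_mult[symmetric])
  have "b = b - ?u h * b"
    using insert.prems(2) by simp
  also have "\<dots> = (\<Sum>g\<in>F. ?u g * c g) - ?u h * (\<Sum>g\<in>F. ?u g * c g)"
    using insert.hyps by (simp add: insert.prems(1) distrib_left mult.assoc[symmetric] idem)
  also have "\<dots> = (\<Sum>g\<in>F. ?u g * (c g - ?u h * c g))"
  proof -
    have "?u h * (?u g * c g) = ?u g * (?u h * c g)" for g
      using comm by (metis mult.assoc)
    then show ?thesis
      by (simp add: sum_distrib_left right_diff_distrib sum_subtractf)
  qed
  finally show ?case
    using insert.prems(2) by (intro insert.IH[of b "\<lambda>g. c g - ?u h * c g"]) auto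
qed simp

text \<open>Since \<B> need not have a unit, the translates of \<open>\<phi> 1\<close> jointly take
  over its role of detecting zero.\<close>

lemma translated_units_separate:
  assumes "\<And>g. \<beta> g (\<phi> 1) * b = 0"
  shows "b = 0"
proof -
  obtain F c where F: "finite F" "b = (\<Sum>g\<in>F. \<beta> g (\<phi> (c g)))"
    using generated by blast
  have "b = (\<Sum>g\<in>F. \<beta> g (\<phi> 1) * \<beta> g (\<phi> (c g)))"
    by (simp add: F(2) \<beta>_mult[symmetric] \<phi>_mult[symmetric])
  with F(1) show ?thesis
    using assms by (rule translated_units_separate_aux)
qed

end

locale enveloping_action_blocks =
  enveloping_action scaleA D \<alpha> e scaleB \<beta> \<phi>
  for scaleA :: "'k::{comm_ring,comm_monoid_mult} \<Rightarrow> 'a::{ring,monoid_mult} \<Rightarrow> 'a"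
    and D :: "'g::group_add \<Rightarrow> 'a set" and \<alpha> :: "'g \<Rightarrow> 'a \<Rightarrow> 'a" and e :: "'g \<Rightarrow> 'a"
    and scaleB :: "'k \<Rightarrow> 'b::ring \<Rightarrow> 'b"
    and \<beta> :: "'g \<Rightarrow> 'b \<Rightarrow> 'b" and \<phi> :: "'a \<Rightarrow> 'b" +
  fixes P :: "'a set"
  assumes blocks: "block_idempotents P"
begin

lemma
  assumes "p \<in> P"
  shows P_idem: "p * p = p" and P_nonzero: "p \<noteq> 0" and P_central: "p * a = a * p"
    and P_minimal: "f * f = f \<Longrightarrow> (\<And>a. f * a = a * f) \<Longrightarrow> p * f = f \<Longrightarrow> f = 0 \<or> f = p"
  using blocks assms unfolding block_idempotents_def by blast+

lemma P_separates: "(\<And>p. p \<in> P \<Longrightarrow> p * a = 0) \<Longrightarrow> a = 0"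
  using blocks unfolding block_idempotents_def by blast

lemma P_complete: "\<exists>a. \<forall>p\<in>P. p * a = p * f p"
  using blocks unfolding block_idempotents_def by blast

section \<open>The translates of the blocks as minimal central idempotents of \<B>\<close>

definition X :: "'b set" where
  "X = {\<beta> g (\<phi> p) | g p. p \<in> P}"

lemma \<phi>_in_X: "p \<in> P \<Longrightarrow> \<phi> p \<in> X"
  unfolding X_def using \<beta>_zero_group by (metis (mono_tags, lifting) mem_Collect_eq)

lemma \<beta>_in_X: "x \<in> X \<Longrightarrow> \<beta> g x \<in> X"
  unfolding X_def using \<beta>_\<beta> by blast

lemma X_idem: "x \<in> X \<Longrightarrow> x * x = x"
  unfolding X_def by (auto simp: \<beta>_mult[symmetric] \<phi>_mult[symmetric] P_idem)

lemma X_central: "x \<in> X \<Longrightarrow> x * b = b * x"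
  unfolding X_def by (auto intro!: \<beta>_central \<phi>_central P_central)

lemma X_nonzero: "x \<in> X \<Longrightarrow> x \<noteq> 0"
  unfolding X_def using P_nonzero \<beta>_eq_iff[of _ _ 0] \<phi>_eq_iff[of _ 0] by auto

text \<open>Translation by \<open>- g\<close> puts \<open>f\<close> below \<open>\<phi> p\<close>,
  hence into the ideal \<phi>(\<A>), where minimality of \<open>p\<close> applies.\<close>

lemma X_minimal:
  assumes "x \<in> X" "f * f = f" "\<And>b. f * b = b * f" "x * f = f"
  shows "f = 0 \<or> f = x"
proof -
  obtain g p where p: "x = \<beta> g (\<phi> p)" "p \<in> P"
    using assms(1) by (auto simp: X_def)
  define f' where "f' = \<beta> (- g) f"
  have f: "f = \<beta> g f'"
    by (simp add: f'_def \<beta>_\<beta>)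
  have "\<phi> p * f' = f'"
    using assms(4) by (simp add: f p \<beta>_mult[symmetric] \<beta>_eq_iff)
  then obtain a where a: "f' = \<phi> a"
    using range_\<phi>_mult(1)[of p f'] by auto
  have "p * a = a"
    using \<open>\<phi> p * f' = f'\<close> by (simp add: a \<phi>_mult[symmetric] \<phi>_eq_iff)
  moreover have "a * a = a"
    using assms(2) by (simp add: f a \<beta>_mult[symmetric] \<phi>_mult[symmetric] \<beta>_eq_iff \<phi>_eq_iff)
  moreover have "a * b = b * a" for b
    using assms(3)[of "\<beta> g (\<phi> b)"]
    by (simp add: f a \<beta>_mult[symmetric] \<phi>_mult[symmetric] \<beta>_eq_iff \<phi>_eq_iff)
  ultimately have "a = 0 \<or> a = p"
    using P_minimal[OF p(2)] by blast
  then show ?thesis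
    by (auto simp: f a p)
qed

text \<open>The product is a central idempotent below both factors; if it were nonzero, minimality
  would make it equal to each of them.\<close>

lemma X_orthogonal:
  assumes "x \<in> X" "y \<in> X" "x \<noteq> y"
  shows "x * y = 0"
proof -
  have 1: "x * y * b = b * (x * y)" for b
    using X_central[OF assms(1)] X_central[OF assms(2)] by (metis mult.assoc)
  have 2: "x * (x * y) = x * y" "y * (x * y) = x * y"
    using X_idem[OF assms(1)] X_idem[OF assms(2)] X_central[OF assms(2)]
    by (metis mult.assoc)+
  then have "x * y * (x * y) = x * y"
    by (simp add: mult.assoc)
  then show ?thesis
    using X_minimal[OF assms(1), of "x * y"] X_minimal[OF assms(2), of "x * y"] 1 2 assms(3)
    by metis
qed

text \<open>The product lies in \<phi>(\<A>) and, by orthogonality, is annihilated by every element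
  of \<phi>(P).\<close>

lemma X_mult_\<phi>_eq_0:
  assumes "x \<in> X" "x \<notin> \<phi> ` P"
  shows "x * \<phi> a = 0"
proof -
  obtain b where b: "x * \<phi> a = \<phi> b"
    using range_\<phi>_mult(2) by (meson imageE)
  have "p * b = 0" if "p \<in> P" for p
  proof -
    have "\<phi> p * x = 0"
      using that assms by (intro X_orthogonal) (auto simp: \<phi>_in_X)
    then have "\<phi> (p * b) = 0"
      by (simp add: \<phi>_mult b[symmetric] mult.assoc[symmetric])
    then show ?thesis
      using \<phi>_eq_iff[of _ 0] by simp
  qed
  then have "b = 0"
    by (rule P_separates)
  with b show ?thesis
    by simp
qed

lemma X_separates_zero:
  assumes "\<And>x. x \<in> X \<Longrightarrow> x * b = 0"
  shows "b = 0"
proof (rule translated_units_separate)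
  fix g
  \<comment> \<open>Translated back, \<open>\<beta> g (\<phi> 1) * b\<close> lies in \<phi>(\<A>),
    where the blocks in \<open>P\<close> detect zero.\<close>
  obtain a where a: "\<phi> 1 * \<beta> (- g) b = \<phi> a"
    using range_\<phi>_mult(1) by (meson imageE)
  have "p * a = 0" if "p \<in> P" for p
  proof -
    have "\<beta> g (\<phi> p * \<beta> (- g) b) = 0"
      using assms[of "\<beta> g (\<phi> p)"] that by (simp add: \<beta>_mult \<beta>_\<beta> \<beta>_in_X \<phi>_in_X)
    then have "\<phi> p * \<beta> (- g) b = 0"
      using \<beta>_eq_iff[of _ _ 0] by simp
    then have "\<phi> (p * a) = 0"
      by (simp add: \<phi>_mult a[symmetric] mult.assoc[symmetric])
        (simp add: \<phi>_mult[symmetric])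
    then show ?thesis
      using \<phi>_eq_iff[of _ 0] by simp
  qed
  then have "a = 0"
    by (rule P_separates)
  then have "\<beta> g (\<phi> 1 * \<beta> (- g) b) = 0"
    using a by simp
  then show "\<beta> g (\<phi> 1) * b = 0"
    by (simp add: \<beta>_mult \<beta>_\<beta>)
qed

lemma X_separates:
  assumes "\<And>x. x \<in> X \<Longrightarrow> x * b = x * b'"
  shows "b = b'"
  using X_separates_zero[of "b - b'"] assms by (simp add: right_diff_distrib)

section \<open>Multipliers from families of block elements\<close>

definition block_family :: "('b \<Rightarrow> 'b) \<Rightarrow> bool" where
  "block_family c \<longleftrightarrow> (\<forall>x\<in>X. x * c x = c x)"

text \<open>The formal product of the \<open>c x\<close>, acting on \<B> by right and left
  multiplication. \<B> need not be the full product of its blocks, so the existence of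
  \<open>d\<close> has to be proved (\<open>block_glue\<close>); uniqueness comes from
  \<open>X_separates\<close>.\<close>

definition family_multiplier :: "('b \<Rightarrow> 'b) \<Rightarrow> ('b \<Rightarrow> 'b) \<times> ('b \<Rightarrow> 'b)" where
  "family_multiplier c =
     ((\<lambda>b. THE d. \<forall>x\<in>X. x * d = b * c x), (\<lambda>b. THE d. \<forall>x\<in>X. x * d = c x * b))"

text \<open>Left and right multiplication by \<open>c\<close> are treated at once through \<open>m\<close>.\<close>

lemma block_glue:
  fixes m :: "'b \<Rightarrow> 'b \<Rightarrow> 'b"
  assumes c: "block_family c"
    and m_add: "\<And>d b b'. m d (b + b') = m d b + m d b'"
    and m_\<beta>: "\<And>g d b. \<beta> g (m d b) = m (\<beta> g d) (\<beta> g b)"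
    and m_central: "\<And>x d b. x \<in> X \<Longrightarrow> m (x * d) b = x * m d b"
      "\<And>x d b. x \<in> X \<Longrightarrow> x * m d b = m d (x * b)"
    and m_\<phi>: "\<And>d a. m d (\<phi> a) \<in> range \<phi>"
  shows "\<exists>d. \<forall>x\<in>X. x * d = m (c x) b"
proof -
  have m0: "m d 0 = 0" for d
    using m_add[of d 0 0] by simp
  \<comment> \<open>It suffices to treat one translate of \<phi>(\<A>): these span \<B>, and
    \<open>m\<close> is additive in its second argument.\<close>
  have gen: "\<exists>d. \<forall>x\<in>X. x * d = m (c x) (\<beta> g (\<phi> a))" for g a
  proof -
    \<comment> \<open>Moved back by \<open>- g\<close>, the required components on the blocks in
      \<phi>(P) become elements of \<A>, which \<open>P_complete\<close> glues to a single
      \<open>a'\<close>.\<close>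
    define f where "f p = inv \<phi> (m (\<beta> (- g) (c (\<beta> g (\<phi> p)))) (\<phi> a))" for p
    have f: "\<phi> (f p) = m (\<beta> (- g) (c (\<beta> g (\<phi> p)))) (\<phi> a)" for p
      unfolding f_def by (rule f_inv_into_f[OF m_\<phi>])
    obtain a' where a': "\<And>p. p \<in> P \<Longrightarrow> p * a' = p * f p"
      using P_complete[of f] by blast
    have "x * \<beta> g (\<phi> a') = m (c x) (\<beta> g (\<phi> a))" if x: "x \<in> X" for x
    proof -
      define y where "y = \<beta> (- g) x"
      have y: "y \<in> X" "x = \<beta> g y"
        using x by (simp_all add: y_def \<beta>_in_X \<beta>_\<beta>)
      have "\<beta> (- g) (c x) = \<beta> (- g) (x * c x)"
        using c x by (simp add: block_family_def)
      then have yc: "y * \<beta> (- g) (c x) = \<beta> (- g) (c x)"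
        by (simp add: \<beta>_mult y_def)
      have "y * \<phi> a' = m (\<beta> (- g) (c x)) (\<phi> a)"
      proof (cases "y \<in> \<phi> ` P")
        case True
        then obtain p where p: "p \<in> P" "y = \<phi> p"
          by auto
        have "y * \<phi> a' = \<phi> (p * f p)"
          by (simp add: p \<phi>_mult[symmetric] a')
        also have "\<dots> = y * m (\<beta> (- g) (c x)) (\<phi> a)"
          by (simp add: \<phi>_mult f p y(2))
        also have "\<dots> = m (\<beta> (- g) (c x)) (\<phi> a)"
          using yc by (simp add: m_central(1)[OF y(1), symmetric])
        finally show ?thesis .
      next
        case False
        \<comment> \<open>Blocks outside \<phi>(P) annihilate \<phi>(\<A>), so both sides vanish
          there.\<close>
        have "m (\<beta> (- g) (c x)) (\<phi> a) = y * m (\<beta> (- g) (c x)) (\<phi> a)"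
          using yc by (simp add: m_central(1)[OF y(1), symmetric])
        also have "\<dots> = 0"
          by (simp add: m_central(2) y X_mult_\<phi>_eq_0[OF y(1) False] m0)
        finally show ?thesis
          by (simp add: X_mult_\<phi>_eq_0[OF y(1) False])
      qed
      then have "\<beta> g (y * \<phi> a') = \<beta> g (m (\<beta> (- g) (c x)) (\<phi> a))"
        by simp
      then show ?thesis
        by (simp add: \<beta>_mult m_\<beta> \<beta>_\<beta> y(2))
    qed
    then show ?thesis
      by blast
  qed
  obtain F a where F: "b = (\<Sum>g\<in>F. \<beta> g (\<phi> (a g)))"
    using generated by blast
  have "\<forall>g. \<exists>d. \<forall>x\<in>X. x * d = m (c x) (\<beta> g (\<phi> (a g)))"
    using gen by blast
  then obtain d where d: "\<forall>g. \<forall>x\<in>X. x * d g = m (c x) (\<beta> g (\<phi> (a g)))"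
    unfolding choice_iff by blast
  have "x * (\<Sum>g\<in>F. d g) = m (c x) b" if "x \<in> X" for x
    by (simp add: F sum_distrib_left d that additive_sum[of "m (c x)", OF m_add])
  then show ?thesis
    by blast
qed

text \<open>This turns the descriptive definition into an equation on each block; with
  \<open>X_separates\<close>, identities between multipliers become identities in \<B>.\<close>

lemma X_family_multiplier_fst:
  assumes c: "block_family c" and x: "x \<in> X"
  shows "x * fst (family_multiplier c) b = b * c x"
proof -
  have "\<exists>d. \<forall>x\<in>X. x * d = b * c x"
  proof (rule block_glue[OF c, where m = "\<lambda>d b. b * d"])
    show "b * (x * d) = x * (b * d)" if "x \<in> X" for x d b
      using X_central[OF that] by (metis mult.assoc)
  qed (auto simp: distrib_right \<beta>_mult range_\<phi>_mult mult.assoc)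
  then have "\<exists>!d. \<forall>x\<in>X. x * d = b * c x"
    by (metis X_separates)
  from theI'[OF this] x show ?thesis
    by (simp add: family_multiplier_def)
qed

lemma X_family_multiplier_snd:
  assumes c: "block_family c" and x: "x \<in> X"
  shows "x * snd (family_multiplier c) b = c x * b"
proof -
  have "\<exists>d. \<forall>x\<in>X. x * d = c x * b"
  proof (rule block_glue[OF c, where m = "\<lambda>d b. d * b"])
    show "x * (d * b) = d * (x * b)" if "x \<in> X" for x d b
      using X_central[OF that] by (metis mult.assoc)
  qed (auto simp: distrib_left \<beta>_mult range_\<phi>_mult mult.assoc)
  then have "\<exists>!d. \<forall>x\<in>X. x * d = c x * b"
    by (metis X_separates)
  from theI'[OF this] x show ?thesis
    by (simp add: family_multiplier_def)
qed

lemma family_multiplier_in_multipliers: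
  assumes c: "block_family c"
  shows "family_multiplier c \<in> multipliers scaleB"
proof -
  note R = X_family_multiplier_fst[OF c] and L = X_family_multiplier_snd[OF c]
  let ?R = "fst (family_multiplier c)" and ?L = "snd (family_multiplier c)"
  have "?R (x + y) = ?R x + ?R y" "?L (x + y) = ?L x + ?L y" for x y
    by (rule X_separates, simp add: R L distrib_left distrib_right)+
  moreover have "?R (scaleB r x) = scaleB r (?R x)" "?L (scaleB r x) = scaleB r (?L x)" for r x
    by (rule X_separates, simp add: R L B.mult_scale_left B.mult_scale_right)+
  moreover have "?R (b * y) = b * ?R y" for b y
  proof (rule X_separates)
    fix x assume x: "x \<in> X"
    have "x * (b * ?R y) = b * (x * ?R y)"
      using X_central[OF x] by (metis mult.assoc)
    with x show "x * ?R (b * y) = x * (b * ?R y)"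
      by (simp add: R mult.assoc)
  qed
  moreover have "?L (y * b) = ?L y * b" for b y
  proof (rule X_separates)
    fix x assume x: "x \<in> X"
    show "x * ?L (y * b) = x * (?L y * b)"
      by (simp add: L x mult.assoc[symmetric])
  qed
  moreover have "?R a * b = a * ?L b" for a b
  proof (rule X_separates)
    fix x assume x: "x \<in> X"
    have "x * (a * ?L b) = a * (x * ?L b)"
      using X_central[OF x] by (metis mult.assoc)
    also have "\<dots> = (x * ?R a) * b"
      by (simp add: L R x mult.assoc)
    finally show "x * (?R a * b) = x * (a * ?L b)"
      by (simp add: mult.assoc)
  qed
  ultimately show ?thesis
    unfolding multipliers_def by (simp add: case_prod_beta)
qed

text \<open>The conjugated multiplier belongs to the family
  \<open>\<lambda>x. \<beta> g (c (\<beta> (- g) x))\<close>, the usual action on functions on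
  \<open>X\<close>.\<close>

lemma
  assumes c: "block_family c" and x: "x \<in> X"
  shows X_multiplier_action_fst:
      "x * fst (multiplier_action \<beta> g (family_multiplier c)) b = b * \<beta> g (c (\<beta> (- g) x))"
    and X_multiplier_action_snd:
      "x * snd (multiplier_action \<beta> g (family_multiplier c)) b = \<beta> g (c (\<beta> (- g) x)) * b"
proof -
  have y: "\<beta> (- g) x \<in> X" and xy: "\<beta> g (\<beta> (- g) z) = z" for z
    using x by (simp_all add: \<beta>_in_X \<beta>_\<beta>)
  have x_mult: "x * \<beta> g z = \<beta> g (\<beta> (- g) x * z)" for z
    by (simp add: \<beta>_mult xy)
  show "x * fst (multiplier_action \<beta> g (family_multiplier c)) b = b * \<beta> g (c (\<beta> (- g) x))"
    by (simp add: multiplier_action_def inv_\<beta> x_mult X_family_multiplier_fst[OF c y])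
      (simp add: \<beta>_mult xy)
  show "x * snd (multiplier_action \<beta> g (family_multiplier c)) b = \<beta> g (c (\<beta> (- g) x)) * b"
    by (simp add: multiplier_action_def inv_\<beta> x_mult X_family_multiplier_snd[OF c y])
      (simp add: \<beta>_mult xy)
qed

text \<open>On the block \<open>x\<close> the coboundary multiplies by the element in the assumption
  \<open>cocycle\<close>, from the right in the first component and from the left in the second; the
  blocks separate elements of \<B>.\<close>

lemma family_multiplier_cocycle:
  assumes c: "\<And>gs. length gs = n \<Longrightarrow> block_family (c gs)"
    and cocycle: "\<And>gs x. length gs = n + 1 \<Longrightarrow> x \<in> X \<Longrightarrow>
      \<beta> (hd gs) (c (tl gs) (\<beta> (- hd gs) x))
      + (\<Sum>i=1..n. alt_sign i (c (merge_at i gs) x)) + alt_sign (n + 1) (c (butlast gs) x) = 0"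
  shows "(\<lambda>gs. family_multiplier (c gs)) \<in> cocycles (multiplier_action \<beta>) (multipliers scaleB) n"
proof -
  have "coboundary (multiplier_action \<beta>) n (\<lambda>gs. family_multiplier (c gs)) gs = 0"
    if len: "length gs = n + 1" for gs
  proof -
    let ?u = "coboundary (multiplier_action \<beta>) n (\<lambda>gs. family_multiplier (c gs)) gs"
    let ?t = "\<lambda>x. \<beta> (hd gs) (c (tl gs) (\<beta> (- hd gs) x))
      + (\<Sum>i=1..n. alt_sign i (c (merge_at i gs) x)) + alt_sign (n + 1) (c (butlast gs) x)"
    have fam: "block_family (c (tl gs))" "block_family (c (butlast gs))"
      "\<And>i. i \<in> {1..n} \<Longrightarrow> block_family (c (merge_at i gs))"
      using len by (auto intro!: c simp: length_merge_at)
    have "fst ?u b = 0" for b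
    proof (rule X_separates_zero)
      fix x assume x: "x \<in> X"
      have "x * fst ?u b = b * ?t x"
        using fam x
        by (simp add: coboundary_def fst_sum sum_fun_apply fst_alt_sign alt_sign_apply distrib_left
            sum_distrib_left alt_sign_mult_right X_multiplier_action_fst X_family_multiplier_fst)
      then show "x * fst ?u b = 0"
        using cocycle[OF len x] by simp
    qed
    moreover have "snd ?u b = 0" for b
    proof (rule X_separates_zero)
      fix x assume x: "x \<in> X"
      have "x * snd ?u b = ?t x * b"
        using fam x
        by (simp add: coboundary_def snd_sum sum_fun_apply snd_alt_sign alt_sign_apply distrib_left
            distrib_right sum_distrib_left sum_distrib_right alt_sign_mult_right alt_sign_mult_left
            X_multiplier_action_snd X_family_multiplier_snd)
      then show "x * snd ?u b = 0"
        using cocycle[OF len x] by simp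
    qed
    ultimately show ?thesis
      by (simp add: prod_eq_iff fun_eq_iff)
  qed
  then show ?thesis
    using c by (auto simp: cocycles_def family_multiplier_in_multipliers)
qed

section \<open>The retraction onto the blocks of the partial action\<close>

definition s :: "'b \<Rightarrow> 'g" where
  "s x = (if x \<in> \<phi> ` P then 0 else SOME g. \<beta> (- g) x \<in> \<phi> ` P)"

lemma s_eq_0: "x \<in> \<phi> ` P \<Longrightarrow> s x = 0"
  by (simp add: s_def)

lemma \<beta>_minus_s:
  assumes "x \<in> X"
  shows "\<beta> (- s x) x \<in> \<phi> ` P"
proof (cases "x \<in> \<phi> ` P")
  case False
  obtain g p where "x = \<beta> g (\<phi> p)" "p \<in> P"
    using assms by (auto simp: X_def)
  then have "\<beta> (- g) x \<in> \<phi> ` P"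
    by (simp add: \<beta>_\<beta>)
  with False show ?thesis
    unfolding s_def by (simp add: someI[of "\<lambda>g. \<beta> (- g) x \<in> \<phi> ` P"])
qed (simp add: s_def)

text \<open>A tuple with a start \<open>x\<close> is a path in the action groupoid through
  \<open>x\<close>, \<open>\<beta> (- g_1) x\<close>, \<open>\<beta> (- (g_1 + g_2)) x\<close> and
  so on; each arrow is conjugated by the values of \<open>s\<close> at its two ends.\<close>

primrec retract :: "'b \<Rightarrow> 'g list \<Rightarrow> 'g list" where
  "retract x [] = []"
| "retract x (g # gs) = (- s x + g + s (\<beta> (- g) x)) # retract (\<beta> (- g) x) gs"

lemma length_retract [simp]: "length (retract x gs) = length gs"
  by (induction gs arbitrary: x) auto

text \<open>The values of \<open>s\<close> at inner blocks cancel, so only the ends of the path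
  contribute.\<close>

lemma sum_list_take_retract:
  "sum_list (take i (retract x gs)) =
     - s x + sum_list (take i gs) + s (\<beta> (- sum_list (take i gs)) x)"
proof (induction gs arbitrary: x i)
  case (Cons g gs)
  then show ?case
    by (cases i) (simp_all add: \<beta>_\<beta> minus_add add.assoc)
qed simp

lemma retract_eq_Nil_iff [simp]: "retract x gs = [] \<longleftrightarrow> gs = []"
  by (cases gs) auto

lemma butlast_retract: "butlast (retract x gs) = retract x (butlast gs)"
  by (induction gs arbitrary: x) auto

text \<open>Merging skips one block of the path, and the two occurrences of its \<open>s\<close>
  cancel.\<close>

lemma merge_at_retract:
  "0 < i \<Longrightarrow> i < length gs \<Longrightarrow> merge_at i (retract x gs) = retract x (merge_at i gs)"
proof (induction gs arbitrary: x i)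
  case (Cons g gs)
  obtain j where i: "i = Suc j"
    using Cons.prems(1) by (cases i) auto
  show ?case
  proof (cases j)
    case 0
    obtain h hs where "gs = h # hs"
      using Cons.prems i by (cases gs) auto
    then show ?thesis
      by (simp add: i 0 merge_at_Cons_Cons \<beta>_\<beta> minus_add add.assoc)
  next
    case (Suc k)
    then show ?thesis
      using Cons by (simp add: i merge_at_Suc_Cons)
  qed
qed simp

text \<open>Here the normalisation of \<open>s\<close> enters: it is \<open>0\<close> at every block
  of such a path.\<close>

lemma retract_eq_self:
  assumes "\<And>i. i \<le> length gs \<Longrightarrow> \<beta> (- sum_list (take i gs)) x \<in> \<phi> ` P"
  shows "retract x gs = gs"
  using assms
proof (induction gs arbitrary: x)
  case (Cons g gs)
  have "s x = 0"
    using Cons.prems[of 0] by (simp add: s_eq_0)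
  moreover have "s (\<beta> (- g) x) = 0"
    using Cons.prems[of 1] by (simp add: s_eq_0)
  moreover have "\<beta> (- sum_list (take i gs)) (\<beta> (- g) x) \<in> \<phi> ` P" if "i \<le> length gs" for i
    using Cons.prems[of "Suc i"] that by (simp add: \<beta>_\<beta> minus_add)
  ultimately show ?case
    by (simp add: Cons.IH)
qed simp

section \<open>The idempotents of the partial action on the blocks\<close>

lemma mult_\<phi>_e:
  assumes "y \<in> \<phi> ` P" "\<beta> (- g) y \<in> \<phi> ` P"
  shows "y * \<phi> (e g) = y"
proof -
  obtain p q where pq: "y = \<phi> p" "\<beta> (- g) y = \<phi> q"
    using assms by auto
  have "y = \<beta> g (\<beta> (- g) y)"
    by (simp add: \<beta>_\<beta>)
  \<comment> \<open>This intersection is the image of \<open>D g\<close> under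
    \<open>\<phi>\<close>, and \<open>e g\<close> is a unit of \<open>D g\<close>.\<close>
  then have "y \<in> range \<phi> \<inter> \<beta> g ` range \<phi>"
    using pq by (metis IntI imageI rangeI)
  then obtain a where a: "y = \<phi> a" "a \<in> D g"
    using \<phi>_D[of g] by auto
  then obtain b where "a = e g * b"
    unfolding A.D_eq by auto
  then have "a * e g = a"
    by (metis A.e_central A.e_idem mult.assoc)
  then show ?thesis
    by (simp add: a \<phi>_mult[symmetric])
qed

text \<open>Converse of \<open>mult_\<phi>_e\<close>. Here \<open>y\<close> lies in the image of
  \<open>D g\<close>, so its translate lies in \<phi>(\<A>). Were the translate outside \<phi>(P),
  it would annihilate itself, contrary to being a nonzero idempotent.\<close>

lemma \<beta>_minus_in_\<phi>_P:
  assumes "y \<in> \<phi> ` P" "y * \<phi> (e g) = y"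
  shows "\<beta> (- g) y \<in> \<phi> ` P"
proof -
  obtain p where p: "p \<in> P" "y = \<phi> p"
    using assms by auto
  have "p * e g = p"
    using assms(2) by (simp add: p \<phi>_mult[symmetric] \<phi>_eq_iff)
  then have "p \<in> D g"
    unfolding A.D_eq by (metis A.e_central rangeI)
  then have eq: "\<beta> (- g) y = \<phi> (\<alpha> (- g) p)"
    using \<phi>_\<alpha>[of p "- g"] by (simp add: p)
  have X: "\<beta> (- g) y \<in> X"
    using p by (simp add: \<beta>_in_X \<phi>_in_X)
  show ?thesis
  proof (rule ccontr)
    assume "\<beta> (- g) y \<notin> \<phi> ` P"
    from X_mult_\<phi>_eq_0[OF X this, of "\<alpha> (- g) p"] show False
      using X_idem[OF X] X_nonzero[OF X] eq by simp
  qed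
qed

text \<open>\<open>y * \<phi> (e g)\<close> is a central idempotent below the minimal one
  \<open>y\<close>.\<close>

lemma \<phi>_P_mult_\<phi>_e:
  assumes "y \<in> \<phi> ` P"
  shows "y * \<phi> (e g) = 0 \<or> y * \<phi> (e g) = y"
proof -
  have y: "y \<in> X"
    using assms \<phi>_in_X by auto
  have e: "\<phi> (e g) * b = b * \<phi> (e g)" for b
    by (rule \<phi>_central) (rule A.e_central)
  have ee: "\<phi> (e g) * \<phi> (e g) = \<phi> (e g)"
    by (simp add: \<phi>_mult[symmetric] A.e_idem)
  show ?thesis
  proof (rule X_minimal[OF y])
    show "y * (y * \<phi> (e g)) = y * \<phi> (e g)"
      by (simp add: mult.assoc[symmetric] X_idem[OF y])
    show "y * \<phi> (e g) * b = b * (y * \<phi> (e g))" for b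
      using e X_central[OF y] by (metis mult.assoc)
    show "y * \<phi> (e g) * (y * \<phi> (e g)) = y * \<phi> (e g)"
      using e ee X_idem[OF y] by (metis mult.assoc)
  qed
qed

lemma \<phi>_P_mult_\<phi>_prod_list:
  assumes "y \<in> \<phi> ` P"
  shows "y * \<phi> (prod_list (map e gs)) = (if \<forall>g\<in>set gs. y * \<phi> (e g) = y then y else 0)"
proof (induction gs)
  case Nil
  then show ?case
    using assms by (auto simp: \<phi>_mult[symmetric])
next
  case (Cons g gs)
  have "y * \<phi> (prod_list (map e (g # gs))) = y * \<phi> (e g) * \<phi> (prod_list (map e gs))"
    by (simp add: \<phi>_mult mult.assoc)
  then show ?case
    using \<phi>_P_mult_\<phi>_e[OF assms, of g] Cons.IH X_nonzero \<phi>_in_X assms by auto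
qed

text \<open>Thus the idempotent of a tuple selects the blocks whose path stays in the full
  subgroupoid over \<phi>(P).\<close>

lemma \<phi>_P_mult_\<phi>_tuple_idem:
  assumes "y \<in> \<phi> ` P"
  shows "y * \<phi> (tuple_idem e gs) =
    (if \<forall>i\<le>length gs. \<beta> (- sum_list (take i gs)) y \<in> \<phi> ` P then y else 0)"
proof -
  have "tuple_idem e gs =
      prod_list (map e (map (\<lambda>i. sum_list (take i gs)) [1..<Suc (length gs)]))"
    by (simp add: tuple_idem_def comp_def del: upt_Suc)
  then have "y * \<phi> (tuple_idem e gs) =
      (if \<forall>i\<in>{1..<Suc (length gs)}. y * \<phi> (e (sum_list (take i gs))) = y then y else 0)"
    by (simp add: \<phi>_P_mult_\<phi>_prod_list[OF assms] del: upt_Suc map_map)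
  \<comment> \<open>The index \<open>0\<close>, absent on the left, is the assumption that
    \<open>y\<close> itself lies in \<phi>(P).\<close>
  moreover have "(\<forall>i\<in>{1..<Suc (length gs)}. y * \<phi> (e (sum_list (take i gs))) = y) \<longleftrightarrow>
      (\<forall>i\<le>length gs. \<beta> (- sum_list (take i gs)) y \<in> \<phi> ` P)"
  proof
    assume l: "\<forall>i\<in>{1..<Suc (length gs)}. y * \<phi> (e (sum_list (take i gs))) = y"
    show "\<forall>i\<le>length gs. \<beta> (- sum_list (take i gs)) y \<in> \<phi> ` P"
    proof (intro allI impI)
      fix i assume "i \<le> length gs"
      then show "\<beta> (- sum_list (take i gs)) y \<in> \<phi> ` P"
        using assms l by (cases "i = 0") (auto intro!: \<beta>_minus_in_\<phi>_P)
    qed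
  qed (auto intro!: mult_\<phi>_e assms)
  ultimately show ?thesis
    by simp
qed

section \<open>The globalizing family of block elements\<close>

definition extension :: "('g list \<Rightarrow> 'a) \<Rightarrow> 'g list \<Rightarrow> 'b \<Rightarrow> 'b" where
  "extension w gs x = x * \<beta> (s x) (\<phi> (w (retract x gs)))"

lemma block_family_extension: "block_family (extension w gs)"
  by (simp add: block_family_def extension_def mult.assoc[symmetric] X_idem)

text \<open>Identify the block \<open>x\<close> with its base block in \<phi>(P) through
  \<open>s x\<close>. The claim is then the partial cocycle identity of \<open>w\<close> at the
  retracted tuple, whose path stays in \<phi>(P): there the partial idempotents act as identities
  and \<open>\<alpha>\<close> becomes \<open>\<beta>\<close>.\<close>

lemma extension_cocycle:
  assumes w: "w \<in> par_cocycles \<alpha> e n" and len: "length gs = n + 1" and x: "x \<in> X"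
  shows "\<beta> (hd gs) (extension w (tl gs) (\<beta> (- hd gs) x))
      + (\<Sum>i=1..n. alt_sign i (extension w (merge_at i gs) x))
      + alt_sign (n + 1) (extension w (butlast gs) x) = 0"
proof -
  \<comment> \<open>\<open>\<psi>\<close> projects \<A> to the base block \<open>y\<close> of
    \<open>x\<close> and transports the result to \<open>x\<close>.\<close>
  define \<psi> where "\<psi> a = x * \<beta> (s x) (\<phi> a)" for a
  have \<psi>_add: "\<psi> (a + b) = \<psi> a + \<psi> b" for a b
    by (simp add: \<psi>_def \<phi>_plus \<beta>_plus distrib_left)
  define y where "y = \<beta> (- s x) x"
  have y: "y \<in> \<phi> ` P" and xy: "x = \<beta> (s x) y"
    using x by (simp_all add: y_def \<beta>_minus_s \<beta>_\<beta>)
  have \<psi>_eq: "\<psi> a = \<beta> (s x) (y * \<phi> a)" for a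
    using xy by (simp add: \<psi>_def \<beta>_mult)
  let ?hs = "retract x gs"
  \<comment> \<open>From \<open>y\<close>, the retracted path runs through the base blocks of the
    original path, so the idempotents are absorbed.\<close>
  have \<psi>_e: "\<psi> (e (sum_list (take i ?hs)) * a) = \<psi> a" for i a
  proof -
    have "\<beta> (- sum_list (take i ?hs)) y =
        \<beta> (- s (\<beta> (- sum_list (take i gs)) x)) (\<beta> (- sum_list (take i gs)) x)"
      by (simp add: sum_list_take_retract y_def \<beta>_\<beta> minus_add add.assoc)
    also have "\<dots> \<in> \<phi> ` P"
      by (intro \<beta>_minus_s \<beta>_in_X x)
    finally show ?thesis
      using mult_\<phi>_e[OF y] by (simp add: \<psi>_eq \<phi>_mult mult.assoc[symmetric])
  qed
  obtain g gs' where gs: "gs = g # gs'"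
    using len by (cases gs) auto
  define z where "z = \<beta> (- g) x"
  define h where "h = - s x + g + s z"
  have zX: "z \<in> X"
    using x by (simp add: z_def \<beta>_in_X)
  have hs: "?hs = h # retract z gs'"
    by (simp add: gs h_def z_def)
  have hy: "\<beta> (- h) y = \<beta> (- s z) z"
    by (simp add: h_def z_def y_def \<beta>_\<beta> minus_add add.assoc)
  have "\<psi> (\<alpha> h (e (- h) * a)) = \<beta> g (z * \<beta> (s z) (\<phi> a))" for a
  proof -
    have "e (- h) * a \<in> D (- h)"
      by (simp add: A.D_eq)
    then have "y * \<phi> (\<alpha> h (e (- h) * a)) = \<beta> h (\<beta> (- h) y * \<phi> (e (- h)) * \<phi> a)"
      by (simp add: \<phi>_\<alpha> \<phi>_mult \<beta>_mult \<beta>_\<beta> mult.assoc)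
    also have "\<beta> (- h) y * \<phi> (e (- h)) = \<beta> (- h) y"
      using \<beta>_minus_s[OF zX] y by (intro mult_\<phi>_e) (simp_all add: hy[symmetric] \<beta>_\<beta>)
    finally have "\<psi> (\<alpha> h (e (- h) * a)) = \<beta> (s x + h) (\<beta> (- s z) z * \<phi> a)"
      by (simp add: \<psi>_eq hy \<beta>_\<beta>)
    \<comment> \<open>The purpose of conjugating \<open>g\<close> by \<open>s\<close>: moving by
      \<open>h\<close> and then to \<open>x\<close> is the same as moving to \<open>z\<close> and
      then by \<open>g\<close>.\<close>
    also have "s x + h = g + s z"
      by (simp add: h_def add.assoc[symmetric])
    also have "\<beta> (g + s z) (\<beta> (- s z) z * \<phi> a) = \<beta> g (z * \<beta> (s z) (\<phi> a))"
      by (simp add: \<beta>_mult \<beta>_\<beta>[symmetric]) (simp add: \<beta>_\<beta>)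
    finally show ?thesis .
  qed
  then have first: "\<psi> (\<alpha> (hd ?hs) (e (- hd ?hs) * w (tl ?hs))) =
      \<beta> (hd gs) (extension w (tl gs) (\<beta> (- hd gs) x))"
    unfolding hs by (simp add: gs extension_def flip: z_def)
  have middle: "(\<Sum>i=1..n. \<psi> (alt_sign i (e (sum_list (take i ?hs)) * w (merge_at i ?hs)))) =
      (\<Sum>i=1..n. alt_sign i (extension w (merge_at i gs) x))"
    using len
    by (intro sum.cong refl, simp add: additive_alt_sign[of \<psi>, OF \<psi>_add] \<psi>_e merge_at_retract)
      (simp add: \<psi>_def extension_def)
  \<comment> \<open>The full sum is the partial sum at \<open>length gs\<close>, where
    \<open>take\<close> returns the whole tuple.\<close>
  have last: "\<psi> (alt_sign (n + 1) (e (sum_list ?hs) * w (butlast ?hs))) =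
      alt_sign (n + 1) (extension w (butlast gs) x)"
    using \<psi>_e[of "length gs"]
    by (simp add: additive_alt_sign[of \<psi>, OF \<psi>_add] butlast_retract)
      (simp add: \<psi>_def extension_def)
  have "par_coboundary \<alpha> e n w ?hs = 0"
    using w len by (simp add: par_cocycles_def)
  then have "\<psi> (par_coboundary \<alpha> e n w ?hs) = 0"
    by (simp add: \<psi>_def)
  then show ?thesis
    unfolding par_coboundary_def \<psi>_add additive_sum[of \<psi>, OF \<psi>_add] first middle last .
qed

text \<open>If the path of \<open>x\<close> stays in \<phi>(P), the retraction fixes
  \<open>gs\<close> and the tuple idempotent fixes \<open>x\<close>; otherwise \<open>x\<close>
  annihilates that idempotent and both sides vanish on \<open>x\<close>.\<close>

lemma extension_restricts:
  assumes w: "w \<in> par_cocycles \<alpha> e n" and len: "length gs = n"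
  shows "\<phi> (w gs) = fst (family_multiplier (extension w gs)) (\<phi> (tuple_idem e gs))"
proof (rule X_separates)
  fix x assume x: "x \<in> X"
  let ?t = "tuple_idem e gs"
  obtain a where a: "w gs = ?t * a"
    using w len by (auto simp: par_cocycles_def par_cochains_def)
  have "x * \<phi> (w gs) = \<phi> ?t * extension w gs x"
  proof (cases "x \<in> \<phi> ` P \<and> (\<forall>i\<le>length gs. \<beta> (- sum_list (take i gs)) x \<in> \<phi> ` P)")
    case True
    then have "x * \<phi> ?t = x"
      using \<phi>_P_mult_\<phi>_tuple_idem by simp
    moreover have "extension w gs x = x * \<phi> (w gs)"
      using True by (simp add: extension_def s_eq_0 retract_eq_self)
    ultimately show ?thesis
      using X_central[OF x, of "\<phi> ?t"] by (simp add: mult.assoc[symmetric])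
  next
    case False
    have "x * \<phi> ?t = 0"
    proof (cases "x \<in> \<phi> ` P")
      case True
      then show ?thesis
        using False \<phi>_P_mult_\<phi>_tuple_idem[OF True, of gs] by argo
    next
      case False
      then show ?thesis
        by (rule X_mult_\<phi>_eq_0[OF x])
    qed
    moreover from this have "\<phi> ?t * x = 0"
      by (simp add: X_central[OF x])
    \<comment> \<open>\<open>w gs\<close> is a multiple of the tuple idempotent, so the left side
      vanishes as well.\<close>
    ultimately show ?thesis
      by (simp add: a \<phi>_mult extension_def mult.assoc[symmetric])
  qed
  then show "x * \<phi> (w gs) = x * fst (family_multiplier (extension w gs)) (\<phi> ?t)"
    by (simp add: X_family_multiplier_fst[OF block_family_extension x])
qed

lemma globalizable_par_cocycle:
  assumes "w \<in> par_cocycles \<alpha> e n"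
  shows "globalizable scaleB \<beta> \<phi> e n w"
  unfolding globalizable_def
  using family_multiplier_cocycle[of n "extension w", OF block_family_extension
      extension_cocycle[OF assms]] extension_restricts[OF assms]
  by (intro bexI[of _ "\<lambda>gs. family_multiplier (extension w gs)"]) auto

end

theorem theorem3p20:
  fixes scaleA :: "'k::{comm_ring,comm_monoid_mult} \<Rightarrow> 'a::{ring,monoid_mult} \<Rightarrow> 'a"
    and scaleB :: "'k \<Rightarrow> 'b::ring \<Rightarrow> 'b"
    and D :: "'g::group_add \<Rightarrow> 'a set" and \<alpha> :: "'g \<Rightarrow> 'a \<Rightarrow> 'a" and e :: "'g \<Rightarrow> 'a"
    and \<beta> :: "'g \<Rightarrow> 'b \<Rightarrow> 'b" and \<phi> :: "'a \<Rightarrow> 'b"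
    and \<Lambda> :: "'i set" and R :: "'i \<Rightarrow> 'r::ring set" and \<Psi> :: "'a \<Rightarrow> 'i \<Rightarrow> 'r"
    and n :: nat and w :: "'g list \<Rightarrow> 'a"
  assumes "\<And>i. i \<in> \<Lambda> \<Longrightarrow> indecomposable_unital_ring_on (R i)"
    and "is_direct_product \<Psi> \<Lambda> R"
    and "unital_partial_action scaleA D \<alpha> e"
    and "enveloping_action scaleA D \<alpha> e scaleB \<beta> \<phi>"
    and "w \<in> par_cocycles \<alpha> e n"
  shows "globalizable scaleB \<beta> \<phi> e n w"
proof -
  obtain P :: "'a set" where "block_idempotents P"
    using direct_product_block_idempotents[OF assms(1,2)] by blast
  then interpret enveloping_action_blocks scaleA D \<alpha> e scaleB \<beta> \<phi> P
    using assms(4) by (simp add: enveloping_action_blocks_def enveloping_action_blocks_axioms_def)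
  show ?thesis
    using assms(5) by (rule globalizable_par_cocycle)
qed

end
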